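(* Let $1\le p<\infty$, let $\eta>0$, and assume that $\mu$ has the $\eta$-annular decay property at $x_0$. Then there is a constant $C>0$, independent of $r$ and $R$, such that $$\operatorname{cap}_p(B_r,B_R)\le C\Bigl(1-\frac{r}{R}\Bigr)^{\eta-p}\frac{\mu(B_R)}{R^p}\qquad\text{whenever } 0<r<R.$$ If $\mu$ has the global $\eta$-annular decay property, then $C$ can be chosen independent of $x_0$.
   Context: $X=(X,d,\mu)$ is a metric space equipped with a metric $d$ and a positive complete Borel measure $\mu$ such that $0<\mu(B)<\infty$ for all balls $B\subset X$. Write $B(x,r)=\{y\in X: d(y,x)<r\}$; $x_0\in X$ is a fixed but arbitrary point and $B_r=B(x_0,r)$. Annular decay: for $\eta>0$, $\mu$ has the $\eta$-annular decay ($\eta$-AD) property at $x$ if there is a constant $C$ such that $\mu(B(x,R)\setminus B(x,r))\le C(1-r/R)^\eta\mu(B(x,R))$ for all radii $0<r<R$. It has the global $\eta$-AD property if this holds for all $x\in X$ with a common constant $C$. Upper gradients and Newtonian space: curves are nonconstant, compact and rectifiable, parameterized by arc length $ds$. A Borel function $g:X\to[0,\infty]$ is an upper gradient of $f:X\to[-\infty,\infty]$ if for all curves $\gamma:[0,l_\gamma]\to X$, $|f(\gamma(0))-f(\gamma(l_\gamma))|\le\int_\gamma g\,ds$, where the left-hand side is considered to be $\infty$ whenever at least one of the terms therein is infinite. A measurable $g:X\to[0,\infty]$ is a $p$-weak upper gradient of $f$ if this inequality holds for $p$-almost every curve, i.e. except for a family $\Gamma$ of curves for which there is $0\le\rho\in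 L^p(X)$ with $\int_\gamma\rho\,ds=\infty$ for all $\gamma\in\Gamma$. If $f$ has an upper gradient in $L^p(X)$, then $g_f$ denotes its (a.e. unique) minimal $p$-weak upper gradient in $L^p(X)$, i.e. $g_f\le g$ a.e. for every $p$-weak upper gradient $g\in L^p(X)$ of $f$. $N^{1,p}(X)$ is the space of measurable functions $f:X\to[-\infty,\infty]$ (defined everywhere) with $\|f\|_{N^{1,p}(X)}=\bigl(\int_X|f|^p\,d\mu+\inf_g\int_X g^p\,d\mu\bigr)^{1/p}<\infty$, the infimum being over all upper gradients $g$ of $f$. Variational capacity: for $\Omega\subset X$ open and $E\subset\Omega$, $\operatorname{cap}_p(E,\Omega)=\inf_u\int_\Omega g_u^p\,d\mu$, the infimum being over all $u\in N^{1,p}(X)$ with $\chi_E\le u\le1$ in $\Omega$ and $u=0$ on $X\setminus\Omega$. *)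

theory Defs
  imports "HOL-Analysis.Analysis"
begin

text \<open>
  The metric space is the whole of a type of class \<^class>\<open>metric_space\<close>. A complete Borel measure is
  a complete measure whose \<open>\<sigma>\<close>-algebra contains all Borel sets; in particular the completion of a
  measure on the Borel \<open>\<sigma>\<close>-algebra is allowed.
\<close>

locale metric_measure_space = complete_measure \<mu> for \<mu> :: "'a::metric_space measure" +
  assumes space_eq_UNIV: "space \<mu> = UNIV"
    and borel_sets_subset: "sets borel \<subseteq> sets \<mu>"
    and ball_pos: "0 < r \<Longrightarrow> 0 < emeasure \<mu> (ball x r)"
    and ball_finite: "0 < r \<Longrightarrow> emeasure \<mu> (ball x r) < \<infinity>"

definition annular_decay_with :: "'a::metric_space measure \<Rightarrow> real \<Rightarrow> real \<Rightarrow> 'a \<Rightarrow> bool" where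
  "annular_decay_with \<mu> \<eta> C x \<longleftrightarrow>
     (\<forall>r R. 0 < r \<and> r < R \<longrightarrow>
        measure \<mu> (ball x R - ball x r) \<le> C * (1 - r / R) powr \<eta> * measure \<mu> (ball x R))"

definition annular_decay_at :: "'a::metric_space measure \<Rightarrow> real \<Rightarrow> 'a \<Rightarrow> bool" where
  "annular_decay_at \<mu> \<eta> x \<longleftrightarrow> (\<exists>C. annular_decay_with \<mu> \<eta> C x)"

definition global_annular_decay :: "'a::metric_space measure \<Rightarrow> real \<Rightarrow> bool" where
  "global_annular_decay \<mu> \<eta> \<longleftrightarrow> (\<exists>C. \<forall>x. annular_decay_with \<mu> \<eta> C x)"

definition ennpowr :: "ennreal \<Rightarrow> real \<Rightarrow> ennreal" where
  "ennpowr x q = (if x = \<infinity> then \<infinity> else ennreal (enn2real x powr q))"  (* used only for q > 0 *)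

definition curve_length :: "(real \<Rightarrow> 'a::metric_space) \<Rightarrow> real \<Rightarrow> real \<Rightarrow> ennreal" where
  "curve_length \<gamma> a b =
     (SUP (n, t) \<in> {(n :: nat, t :: nat \<Rightarrow> real). mono_on {..n} t \<and> t 0 = a \<and> t n = b}.
        \<Sum>i<n. ennreal (dist (\<gamma> (t i)) (\<gamma> (t (Suc i)))))"

text \<open>
  A nonconstant compact rectifiable curve is given by its arc length parameterization on
  \<open>[0, l]\<close>, where \<open>l > 0\<close> is its length. Such a parameterization is 1-Lipschitz, hence continuous.
  Values of \<open>\<gamma>\<close> outside \<open>[0, l]\<close> are irrelevant.
\<close>

definition arclength_curve :: "(real \<Rightarrow> 'a::metric_space) \<Rightarrow> real \<Rightarrow> bool" where
  "arclength_curve \<gamma> l \<longleftrightarrow> 0 < l \<and>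
     (\<forall>s t. 0 \<le> s \<and> s \<le> t \<and> t \<le> l \<longrightarrow> curve_length \<gamma> s t = ennreal (t - s))"

definition curve_integral :: "(real \<Rightarrow> 'a) \<Rightarrow> real \<Rightarrow> ('a \<Rightarrow> ennreal) \<Rightarrow> ennreal" where
  "curve_integral \<gamma> l g = (\<integral>\<^sup>+ t. g (\<gamma> t) \<partial>lebesgue_on {0..l})"

definition ereal_diff_abs :: "ereal \<Rightarrow> ereal \<Rightarrow> ennreal" where
  "ereal_diff_abs a b = (if \<bar>a\<bar> = \<infinity> \<or> \<bar>b\<bar> = \<infinity> then \<infinity> else e2ennreal \<bar>a - b\<bar>)"

definition upper_gradient :: "('a::metric_space \<Rightarrow> ereal) \<Rightarrow> ('a \<Rightarrow> ennreal) \<Rightarrow> bool" where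
  "upper_gradient f g \<longleftrightarrow> g \<in> borel_measurable borel \<and>
     (\<forall>\<gamma> l. arclength_curve \<gamma> l \<longrightarrow> ereal_diff_abs (f (\<gamma> 0)) (f (\<gamma> l)) \<le> curve_integral \<gamma> l g)"

definition in_Lp :: "'a measure \<Rightarrow> real \<Rightarrow> ('a \<Rightarrow> ennreal) \<Rightarrow> bool" where
  "in_Lp \<mu> p g \<longleftrightarrow> g \<in> borel_measurable \<mu> \<and> (\<integral>\<^sup>+ x. ennpowr (g x) p \<partial>\<mu>) < \<infinity>"

definition exceptional_family ::
  "'a::metric_space measure \<Rightarrow> real \<Rightarrow> ((real \<Rightarrow> 'a) \<times> real) set \<Rightarrow> bool" where
  "exceptional_family \<mu> p \<Gamma> \<longleftrightarrow>
     (\<exists>\<rho>. in_Lp \<mu> p \<rho> \<and> (\<forall>(\<gamma>, l) \<in> \<Gamma>. curve_integral \<gamma> l \<rho> = \<infinity>))"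

definition almost_every_curve ::
  "'a::metric_space measure \<Rightarrow> real \<Rightarrow> ((real \<Rightarrow> 'a) \<Rightarrow> real \<Rightarrow> bool) \<Rightarrow> bool" where
  "almost_every_curve \<mu> p P \<longleftrightarrow>
     exceptional_family \<mu> p {(\<gamma>, l). arclength_curve \<gamma> l \<and> \<not> P \<gamma> l}"

text \<open>
  As \<open>g\<close> is only \<open>\<mu>\<close>-measurable, \<open>g \<circ> \<gamma>\<close> need not be measurable for every curve; that the integral
  along \<open>\<gamma>\<close> is meaningful is part of what holds for almost every curve. (This is automatic if \<open>\<mu>\<close> is
  the completion of a Borel measure, since \<open>g\<close> is then Borel outside a Borel null set.)
\<close>

definition weak_upper_gradient ::
  "'a::metric_space measure \<Rightarrow> real \<Rightarrow> ('a \<Rightarrow> ereal) \<Rightarrow> ('a \<Rightarrow> ennreal) \<Rightarrow> bool" where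
  "weak_upper_gradient \<mu> p f g \<longleftrightarrow> g \<in> borel_measurable \<mu> \<and>
     almost_every_curve \<mu> p (\<lambda>\<gamma> l.
       (\<lambda>t. g (\<gamma> t)) \<in> borel_measurable (lebesgue_on {0..l}) \<and>
       ereal_diff_abs (f (\<gamma> 0)) (f (\<gamma> l)) \<le> curve_integral \<gamma> l g)"

definition is_minimal_weak_upper_gradient ::
  "'a::metric_space measure \<Rightarrow> real \<Rightarrow> ('a \<Rightarrow> ereal) \<Rightarrow> ('a \<Rightarrow> ennreal) \<Rightarrow> bool" where
  "is_minimal_weak_upper_gradient \<mu> p f g \<longleftrightarrow>
     weak_upper_gradient \<mu> p f g \<and> in_Lp \<mu> p g \<and>
     (\<forall>h. weak_upper_gradient \<mu> p f h \<and> in_Lp \<mu> p h \<longrightarrow> (AE x in \<mu>. g x \<le> h x))"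

(* A representative of the a.e. equivalence class; meaningful if f has an upper gradient in L^p. *)
definition minimal_weak_upper_gradient ::
  "'a::metric_space measure \<Rightarrow> real \<Rightarrow> ('a \<Rightarrow> ereal) \<Rightarrow> 'a \<Rightarrow> ennreal" where
  "minimal_weak_upper_gradient \<mu> p f = (SOME g. is_minimal_weak_upper_gradient \<mu> p f g)"

definition newtonian_norm :: "'a::metric_space measure \<Rightarrow> real \<Rightarrow> ('a \<Rightarrow> ereal) \<Rightarrow> ennreal" where
  "newtonian_norm \<mu> p f =
     ennpowr ((\<integral>\<^sup>+ x. ennpowr (e2ennreal \<bar>f x\<bar>) p \<partial>\<mu>)
              + (INF g \<in> {g. upper_gradient f g}. \<integral>\<^sup>+ x. ennpowr (g x) p \<partial>\<mu>)) (1 / p)"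

definition newtonian_space :: "'a::metric_space measure \<Rightarrow> real \<Rightarrow> ('a \<Rightarrow> ereal) set" where
  "newtonian_space \<mu> p = {f. f \<in> borel_measurable \<mu> \<and> newtonian_norm \<mu> p f < \<infinity>}"

definition variational_capacity ::
  "'a::metric_space measure \<Rightarrow> real \<Rightarrow> 'a set \<Rightarrow> 'a set \<Rightarrow> ennreal" where
  "variational_capacity \<mu> p E \<Omega> =
     (INF u \<in> {u \<in> newtonian_space \<mu> p.
                 (\<forall>x\<in>\<Omega>. indicator E x \<le> u x \<and> u x \<le> 1) \<and> (\<forall>x. x \<notin> \<Omega> \<longrightarrow> u x = 0)}.
        \<integral>\<^sup>+ x\<in>\<Omega>. ennpowr (minimal_weak_upper_gradient \<mu> p u x) p \<partial>\<mu>)"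

end

theory Submission
  imports Defs
begin

text \<open>
  The cutoff function of \<open>B\<^sub>r\<close> in \<open>B\<^sub>R\<close> that is linear in \<open>d(x\<^sub>0, x)\<close> has the upper gradient
  \<open>g = (R - r)\<^sup>-\<^sup>1 \<chi>\<close>, with \<open>\<chi>\<close> the characteristic function of the annulus. Hence the capacity is at most
  \<open>\<integral> g\<^sup>p = (R - r)\<^sup>-\<^sup>p \<mu>(B\<^sub>R - B\<^sub>r)\<close>, and annular decay gives the claim.

  This comparison requires that a minimal \<open>p\<close>-weak upper gradient exists. The \<open>p\<close>-weak upper gradients
  in \<open>L\<^sup>p\<close> are closed under pairwise minima and, by monotone convergence along curves, under limits of
  decreasing sequences; so the infimum of \<open>\<integral> g\<^sup>p\<close> is attained, and a minimizer \<open>G\<close> satisfies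
  \<open>min(G, h) = G\<close> a.e. for every competitor \<open>h\<close>. No reflexivity is used, so \<open>p = 1\<close> is included.
\<close>

section \<open>Powers of extended nonnegative reals\<close>

lemma ennpowr_mono:
  assumes "0 \<le> q" "x \<le> y"
  shows "ennpowr x q \<le> ennpowr y q"
  using assms unfolding ennpowr_def
  by (auto intro!: ennreal_leI powr_mono2 enn2real_mono simp: less_top[symmetric] top.extremum_unique)

lemma ennpowr_ennpowr:
  assumes "0 < q"
  shows "ennpowr (ennpowr x q) (1 / q) = x"
  using assms unfolding ennpowr_def
  by (cases x) (auto simp: powr_powr)

lemma ennpowr_cmult:
  assumes "0 < a" "0 < q"
  shows "ennpowr (ennreal a * x) q = ennreal (a powr q) * ennpowr x q"
  using assms unfolding ennpowr_def
  by (cases x) (auto simp: ennreal_mult_top powr_mult ennreal_mult'[symmetric] enn2real_mult ennreal_mult_eq_top_iff)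

lemma ennpowr_le_iff:
  assumes "0 < q"
  shows "ennpowr x q \<le> ennpowr y q \<longleftrightarrow> x \<le> y"
  by (metis assms ennpowr_ennpowr ennpowr_mono less_imp_le divide_pos_pos zero_less_one)

lemma ennpowr_less_top_iff: "ennpowr x q < \<infinity> \<longleftrightarrow> x < \<infinity>"
  by (auto simp: ennpowr_def less_top)

lemma borel_measurable_ennpowr [measurable (raw)]:
  assumes [measurable]: "f \<in> borel_measurable M"
  shows "(\<lambda>x. ennpowr (f x) q) \<in> borel_measurable M"
  unfolding ennpowr_def by measurable

section \<open>Lower integrals, subcurves and arc length\<close>

text \<open>
  No measurability of \<open>f\<close> is assumed: an \<open>L\<^sup>p\<close> function need not be measurable along a given curve,
  and then \<^const>\<open>nn_integral\<close> is a lower integral.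
\<close>

lemma nn_integral_cmult_le:
  "c * (\<integral>\<^sup>+ x. f x \<partial>M) \<le> (\<integral>\<^sup>+ x. c * f x \<partial>M)"
proof -
  have "c * integral\<^sup>S M s \<le> (\<integral>\<^sup>+ x. c * f x \<partial>M)" if "simple_function M s" "s \<le> f" for s
  proof -
    have "c * integral\<^sup>S M s = (\<integral>\<^sup>+ x. c * s x \<partial>M)"
      using that(1) by (simp add: nn_integral_eq_simple_integral)
    also have "\<dots> \<le> (\<integral>\<^sup>+ x. c * f x \<partial>M)"
      using le_funD[OF that(2)] by (intro nn_integral_mono mult_left_mono) auto
    finally show ?thesis .
  qed
  moreover have "{g. simple_function M g \<and> g \<le> f} \<noteq> {}"
    by (auto intro!: exI[of _ "\<lambda>_. 0"] simp: le_fun_def)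
  ultimately show ?thesis
    unfolding nn_integral_def[of M f] by (auto simp: SUP_mult_left_ennreal intro!: SUP_least)
qed

text \<open>Translating a measurable minorant of the shifted function back by \<open>a\<close> gives
  a minorant of \<open>f\<close> with the same integral. Arguing with minorants avoids measurability
  of \<open>f\<close>; the opposite inequality comes from shifting by \<open>- a\<close>.\<close>

lemma nn_integral_lebesgue_shift_le:
  fixes f :: "real \<Rightarrow> ennreal"
  shows "(\<integral>\<^sup>+ x. f (a + x) \<partial>lebesgue) \<le> (\<integral>\<^sup>+ x. f x \<partial>lebesgue)"
proof -
  have "integral\<^sup>S lebesgue s \<le> (\<integral>\<^sup>+ x. f x \<partial>lebesgue)"
    if s: "simple_function lebesgue s" "s \<le> (\<lambda>x. f (a + x))" for s
  proof -
    have m: "(\<lambda>x. s (x - a)) \<in> borel_measurable lebesgue"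
      using measurable_compose[OF lebesgue_affine_measurable[where c="\<lambda>_. 1" and t="-a"]
          borel_measurable_simple_function[OF s(1)]] by simp
    have "integral\<^sup>S lebesgue s = (\<integral>\<^sup>+ x. s (x - a) \<partial>lebesgue)"
      using nn_integral_real_affine_lebesgue[OF m, of 1 a] s(1)
      by (simp add: nn_integral_eq_simple_integral)
    also have "\<dots> \<le> (\<integral>\<^sup>+ x. f x \<partial>lebesgue)"
      using le_funD[OF s(2), of "_ - a"] by (intro nn_integral_mono) simp
    finally show ?thesis .
  qed
  then show ?thesis unfolding nn_integral_def[of lebesgue "\<lambda>x. f (a + x)"] by (auto intro: SUP_least)
qed

lemma nn_integral_lebesgue_shift:
  fixes f :: "real \<Rightarrow> ennreal"
  shows "(\<integral>\<^sup>+ x. f (a + x) \<partial>lebesgue) = (\<integral>\<^sup>+ x. f x \<partial>lebesgue)"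
  using nn_integral_lebesgue_shift_le[of f a]
    nn_integral_lebesgue_shift_le[of "\<lambda>x. f (a + x)" "- a"] by simp

text \<open>Curves start at parameter 0, so the piece over \<open>{s..t}\<close> has to be
  reparameterized before it counts as a curve. Translation invariance shows that this leaves the
  integral unchanged, even for nonmeasurable integrands.\<close>

lemma curve_integral_subcurve:
  "curve_integral (\<lambda>x. \<gamma> (s + x)) (t - s) g = (\<integral>\<^sup>+ x. g (\<gamma> x) \<partial>lebesgue_on {s..t})"
proof -
  have *: "indicator {0..t - s} x = (indicator {s..t} (s + x) :: ennreal)" for x
    by (auto simp: indicator_def)
  show ?thesis unfolding curve_integral_def
    using nn_integral_lebesgue_shift[of "\<lambda>x. g (\<gamma> x) * indicator {s..t} x" s]
    by (simp add: nn_integral_restrict_space *)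
qed

lemma curve_integral_subcurve_le:
  assumes "0 \<le> s" "t \<le> l"
  shows "curve_integral (\<lambda>x. \<gamma> (s + x)) (t - s) g \<le> curve_integral \<gamma> l g"
proof -
  have "(\<integral>\<^sup>+ x. g (\<gamma> x) * indicator {s..t} x \<partial>lebesgue) \<le> (\<integral>\<^sup>+ x. g (\<gamma> x) * indicator {0..l} x \<partial>lebesgue)"
    using assms by (intro nn_integral_mono) (auto simp: indicator_def)
  then show ?thesis
    unfolding curve_integral_subcurve unfolding curve_integral_def by (simp add: nn_integral_restrict_space)
qed

lemma curve_integral_mono:
  "(\<And>x. g x \<le> h x) \<Longrightarrow> curve_integral \<gamma> l g \<le> curve_integral \<gamma> l h"
  unfolding curve_integral_def by (intro nn_integral_mono)

lemma curve_length_shift_le: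
  "curve_length (\<lambda>x. \<gamma> (c + x)) a b \<le> curve_length \<gamma> (c + a) (c + b)"
  unfolding curve_length_def
proof (rule SUP_mono, clarsimp, goal_cases)
  case (1 n t)
  then show ?case
    by (intro exI[of _ n] exI[of _ "\<lambda>i. c + t i"]) (auto simp: mono_on_def)
qed

lemma curve_length_shift:
  "curve_length (\<lambda>x. \<gamma> (c + x)) a b = curve_length \<gamma> (c + a) (c + b)"
  using curve_length_shift_le[of \<gamma> c a b]
    curve_length_shift_le[of "\<lambda>x. \<gamma> (c + x)" "- c" "c + a" "c + b"] by simp

lemma arclength_curve_subcurve:
  assumes "arclength_curve \<gamma> l" "0 \<le> s" "s < t" "t \<le> l"
  shows "arclength_curve (\<lambda>x. \<gamma> (s + x)) (t - s)"
  using assms unfolding arclength_curve_def curve_length_shift by auto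

text \<open>The distance of the endpoints is the sum for the one-step partition, and the supremum
  over all partitions is \<open>t - s\<close>.\<close>

lemma arclength_curve_dist_le:
  assumes "arclength_curve \<gamma> l" "0 \<le> s" "s \<le> t" "t \<le> l"
  shows "dist (\<gamma> s) (\<gamma> t) \<le> t - s"
proof -
  have "ennreal (dist (\<gamma> s) (\<gamma> t)) \<le> curve_length \<gamma> s t"
    unfolding curve_length_def
    using assms
    by (intro SUP_upper2[where i="(1, \<lambda>i. if i = 0 then s else t)"]) (auto simp: mono_on_def)
  then show ?thesis using assms unfolding arclength_curve_def by simp
qed

lemma continuous_on_dist_le:
  fixes f :: "real \<Rightarrow> 'a::metric_space"
  assumes "\<And>s t. a \<le> s \<Longrightarrow> s \<le> t \<Longrightarrow> t \<le> b \<Longrightarrow> dist (f s) (f t) \<le> t - s"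
  shows "continuous_on {a..b} f"
proof (rule continuous_onI)
  fix x e :: real assume x: "x \<in> {a..b}" and e: "0 < e"
  have "dist (f y) (f x) < e" if "y \<in> {a..b}" "dist y x < e" for y
    using assms[of x y] assms[of y x] x that
    by (cases "x \<le> y") (auto simp: dist_commute dist_real_def)
  with e show "\<exists>d>0. \<forall>x'\<in>{a..b}. dist x' x < d \<longrightarrow> dist (f x') (f x) \<le> e"
    by (meson less_imp_le)
qed

lemma arclength_curve_continuous_on:
  "arclength_curve \<gamma> l \<Longrightarrow> continuous_on {0..l} \<gamma>"
  by (rule continuous_on_dist_le) (rule arclength_curve_dist_le)

text \<open>The curve is continuous on its parameter interval, hence Borel there, and Borel sets are
  Lebesgue measurable. Thus Borel functions such as upper gradients are measurable along every
  curve.\<close>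

lemma arclength_curve_measurable:
  assumes "arclength_curve \<gamma> l" "g \<in> borel_measurable borel"
  shows "(\<lambda>t. g (\<gamma> t)) \<in> borel_measurable (lebesgue_on {0..l})"
proof (rule measurable_compose[OF _ assms(2)])
  have "(\<lambda>t. t) \<in> lebesgue_on {0..l} \<rightarrow>\<^sub>M restrict_space borel {0..l}"
    by (intro measurable_restrict_space3) (auto intro: measurable_completion)
  then show "\<gamma> \<in> lebesgue_on {0..l} \<rightarrow>\<^sub>M borel"
    using borel_measurable_continuous_on_restrict[OF arclength_curve_continuous_on[OF assms(1)]]
    by (rule measurable_compose)
qed

section \<open>Calculus of exceptional curve families\<close>

lemma almost_every_curve_mono:
  assumes "almost_every_curve \<mu> p P"
    and "\<And>\<gamma> l. arclength_curve \<gamma> l \<Longrightarrow> P \<gamma> l \<Longrightarrow> Q \<gamma> l"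
  shows "almost_every_curve \<mu> p Q"
  using assms unfolding almost_every_curve_def exceptional_family_def by blast

text \<open>The same \<rho> works: an infinite integral over a bad subcurve forces an infinite
  integral over the whole curve.\<close>

lemma almost_every_curve_subcurves:
  assumes "almost_every_curve \<mu> p P"
  shows "almost_every_curve \<mu> p
    (\<lambda>\<gamma> l. \<forall>s t. 0 \<le> s \<and> s < t \<and> t \<le> l \<longrightarrow> P (\<lambda>x. \<gamma> (s + x)) (t - s))"
proof -
  obtain \<rho> where \<rho>: "in_Lp \<mu> p \<rho>"
    "\<And>\<gamma> l. arclength_curve \<gamma> l \<Longrightarrow> \<not> P \<gamma> l \<Longrightarrow> curve_integral \<gamma> l \<rho> = \<infinity>"
    using assms unfolding almost_every_curve_def exceptional_family_def by blast
  have "curve_integral \<gamma> l \<rho> = \<infinity>"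
    if "arclength_curve \<gamma> l" "0 \<le> s" "s < t" "t \<le> l" "\<not> P (\<lambda>x. \<gamma> (s + x)) (t - s)" for \<gamma> l s t
    using \<rho>(2)[OF arclength_curve_subcurve[OF that(1-4)] that(5)]
      curve_integral_subcurve_le[OF that(2,4), of \<gamma> \<rho>] by (simp add: top.extremum_unique)
  with \<rho>(1) show ?thesis unfolding almost_every_curve_def exceptional_family_def by blast
qed

text \<open>The function \<open>g\<close> itself witnesses that the curves with infinite integral
  are exceptional.\<close>

lemma almost_every_curve_finite_integral:
  assumes "in_Lp \<mu> p g"
  shows "almost_every_curve \<mu> p (\<lambda>\<gamma> l. curve_integral \<gamma> l g < \<infinity>)"
  using assms unfolding almost_every_curve_def exceptional_family_def
  by (auto simp: less_top[symmetric])

text \<open>The witnesses \<open>\<rho> n\<close> are merged into one function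
  \<open>\<sigma>\<close> in \<open>L^p\<close> that dominates a positive multiple of each of them,
  so its integral is infinite along every curve that is bad for some \<open>n\<close>.\<close>

lemma almost_every_curve_all_countable:
  fixes P :: "nat \<Rightarrow> (real \<Rightarrow> 'a::metric_space) \<Rightarrow> real \<Rightarrow> bool"
  assumes p: "0 < p" and ae: "\<And>n. almost_every_curve \<mu> p (P n)"
  shows "almost_every_curve \<mu> p (\<lambda>\<gamma> l. \<forall>n. P n \<gamma> l)"
proof -
  have "\<forall>n. \<exists>\<rho>. in_Lp \<mu> p \<rho> \<and>
      (\<forall>\<gamma> l. arclength_curve \<gamma> l \<longrightarrow> \<not> P n \<gamma> l \<longrightarrow> curve_integral \<gamma> l \<rho> = \<infinity>)"
    using ae unfolding almost_every_curve_def exceptional_family_def by fast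
  then obtain \<rho> where Lp: "\<And>n. in_Lp \<mu> p (\<rho> n)"
    and exc: "\<And>n \<gamma> l. arclength_curve \<gamma> l \<Longrightarrow> \<not> P n \<gamma> l \<Longrightarrow> curve_integral \<gamma> l (\<rho> n) = \<infinity>"
    by metis
  have [measurable]: "\<rho> n \<in> borel_measurable \<mu>" for n using Lp by (simp add: in_Lp_def)
  define I where "I n = enn2real (\<integral>\<^sup>+ x. ennpowr (\<rho> n x) p \<partial>\<mu>)" for n
  have I: "(\<integral>\<^sup>+ x. ennpowr (\<rho> n x) p \<partial>\<mu>) = ennreal (I n)" and I0: "0 \<le> I n" for n
    using Lp[of n] by (simp_all add: in_Lp_def I_def)
  \<comment> \<open>The weights make the weighted energies at most a geometric series; the 1 in the
    denominator guards against \<open>I n = 0\<close>.\<close>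
  define a where "a n = (1/2) ^ n / (1 + I n)" for n
  have a: "0 < a n" "a n * I n \<le> (1/2) ^ n" for n
    using I0[of n] mult_left_le[of "I n / (1 + I n)" "(1/2) ^ n"] by (simp_all add: a_def add_pos_nonneg)
  \<comment> \<open>Summing \<open>p\<close>-th powers instead of the \<open>\<rho> n\<close> themselves avoids Minkowski's inequality.\<close>
  define \<sigma> where "\<sigma> x = ennpowr (\<Sum>n. ennreal (a n) * ennpowr (\<rho> n x) p) (1 / p)" for x
  have \<sigma>p: "ennpowr (\<sigma> x) p = (\<Sum>n. ennreal (a n) * ennpowr (\<rho> n x) p)" for x
    using ennpowr_ennpowr[of "1/p" "\<Sum>n. ennreal (a n) * ennpowr (\<rho> n x) p"] p by (simp add: \<sigma>_def)
  have "(\<integral>\<^sup>+ x. ennpowr (\<sigma> x) p \<partial>\<mu>) = (\<Sum>n. ennreal (a n * I n))"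
    unfolding \<sigma>p using a I0
    by (subst nn_integral_suminf)
       (auto simp: nn_integral_cmult I ennreal_mult less_imp_le)
  also have "\<dots> \<le> (\<Sum>n. ennreal ((1/2) ^ n))"
    by (intro suminf_le ennreal_leI a) auto
  also have "\<dots> = ennreal (\<Sum>n. (1/2) ^ n)"
    by (intro suminf_ennreal2) (auto simp: summable_geometric)
  finally have "(\<integral>\<^sup>+ x. ennpowr (\<sigma> x) p \<partial>\<mu>) < \<infinity>"
    by (metis ennreal_less_top infinity_ennreal_def le_less_trans)
  moreover have "\<sigma> \<in> borel_measurable \<mu>" unfolding \<sigma>_def[abs_def] by measurable
  ultimately have Lp\<sigma>: "in_Lp \<mu> p \<sigma>" by (simp add: in_Lp_def)
  \<comment> \<open>A single term of the series is at most the whole sum; taking the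
    \<open>1/p\<close>-th power turns this into a pointwise bound on
    \<open>\<rho> n\<close>.\<close>
  have le: "ennreal (a n powr (1/p)) * \<rho> n x \<le> \<sigma> x" for n x
  proof -
    have "ennreal (a n powr (1/p)) * \<rho> n x = ennpowr (ennreal (a n) * ennpowr (\<rho> n x) p) (1/p)"
      using p a by (simp add: ennpowr_cmult ennpowr_ennpowr)
    also have "\<dots> \<le> \<sigma> x"
      unfolding \<sigma>_def using p sum_le_suminf[of "\<lambda>n. ennreal (a n) * ennpowr (\<rho> n x) p" "{n}"]
      by (intro ennpowr_mono) simp_all
    finally show ?thesis .
  qed
  have "curve_integral \<gamma> l \<sigma> = \<infinity>" if "arclength_curve \<gamma> l" "\<not> P n \<gamma> l" for n \<gamma> l
  proof -
    have "\<infinity> = ennreal (a n powr (1/p)) * curve_integral \<gamma> l (\<rho> n)"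
      using exc[OF that] a[of n] by (simp add: ennreal_mult_top)
    also have "\<dots> \<le> curve_integral \<gamma> l (\<lambda>x. ennreal (a n powr (1/p)) * \<rho> n x)"
      unfolding curve_integral_def by (rule nn_integral_cmult_le)
    also have "\<dots> \<le> curve_integral \<gamma> l \<sigma>"
      by (intro curve_integral_mono le)
    finally show ?thesis by (simp add: top.extremum_unique)
  qed
  with Lp\<sigma> show ?thesis unfolding almost_every_curve_def exceptional_family_def by blast
qed

text \<open>The countable case for the sequence P, Q, Q, ...\<close>

lemma almost_every_curve_conj:
  assumes "0 < p" "almost_every_curve \<mu> p P" "almost_every_curve \<mu> p Q"
  shows "almost_every_curve \<mu> p (\<lambda>\<gamma> l. P \<gamma> l \<and> Q \<gamma> l)"
proof -
  have "almost_every_curve \<mu> p (\<lambda>\<gamma> l. \<forall>n::nat. if n = 0 then P \<gamma> l else Q \<gamma> l)"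
  proof (rule almost_every_curve_all_countable[OF assms(1)])
    show "almost_every_curve \<mu> p (\<lambda>\<gamma> l. if n = 0 then P \<gamma> l else Q \<gamma> l)" for n :: nat
      using assms by (cases "n = 0") simp_all
  qed
  then show ?thesis by (rule almost_every_curve_mono) (auto dest: spec[of _ 0] spec[of _ 1])
qed

section \<open>Increments on an interval bounded by the integral of a minimum\<close>

text \<open>
  On a sufficiently fine tagged division the integral over each piece is nearly the length of the piece
  times the value at the tag (Henstock's lemma), so on each piece we can use whichever of the two
  bounds is smaller at its tag. This replaces differentiation of absolutely continuous functions.
\<close>

lemma abs_increment_le_integral_min:
  fixes F g h :: "real \<Rightarrow> real"
  assumes ab: "a \<le> b"
    and g: "g integrable_on {a..b}" and h: "h integrable_on {a..b}"
    and m: "(\<lambda>x. min (g x) (h x)) integrable_on {a..b}"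
    and Fg: "\<And>s t. a \<le> s \<Longrightarrow> s \<le> t \<Longrightarrow> t \<le> b \<Longrightarrow> \<bar>F t - F s\<bar> \<le> integral {s..t} g"
    and Fh: "\<And>s t. a \<le> s \<Longrightarrow> s \<le> t \<Longrightarrow> t \<le> b \<Longrightarrow> \<bar>F t - F s\<bar> \<le> integral {s..t} h"
  shows "\<bar>F b - F a\<bar> \<le> integral {a..b} (\<lambda>x. min (g x) (h x))"
proof (rule field_le_epsilon)
  fix e :: real assume e: "0 < e"
  let ?m = "\<lambda>x. min (g x) (h x)"
  \<comment> \<open>The Henstock error of one tagged piece. The errors for \<open>g\<close>,
    \<open>h\<close> and their minimum share the budget \<open>e\<close>, and a division fine for
    the intersection of the three gauges controls all of them.\<close>
  define err where "err f = (\<lambda>(x, K). norm (measure lborel K *\<^sub>R f x - integral K f))" for f :: "real \<Rightarrow> real"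
  have e3: "0 < e / 3" using e by simp
  obtain \<gamma>1 where \<gamma>1: "gauge \<gamma>1"
    "\<And>p. p tagged_partial_division_of cbox a b \<Longrightarrow> \<gamma>1 fine p \<Longrightarrow> sum (err g) p < e / 3"
    using Henstock_lemma[OF g[folded box_real(2)] e3, folded err_def] by blast
  obtain \<gamma>2 where \<gamma>2: "gauge \<gamma>2"
    "\<And>p. p tagged_partial_division_of cbox a b \<Longrightarrow> \<gamma>2 fine p \<Longrightarrow> sum (err h) p < e / 3"
    using Henstock_lemma[OF h[folded box_real(2)] e3, folded err_def] by blast
  obtain \<gamma>3 where \<gamma>3: "gauge \<gamma>3"
    "\<And>p. p tagged_partial_division_of cbox a b \<Longrightarrow> \<gamma>3 fine p \<Longrightarrow> sum (err ?m) p < e / 3"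
    using Henstock_lemma[OF m[folded box_real(2)] e3, folded err_def] by blast
  obtain p where p: "p tagged_division_of {a..b}" "(\<lambda>x. \<gamma>1 x \<inter> \<gamma>2 x \<inter> \<gamma>3 x) fine p"
    using fine_division_exists_real[OF gauge_Int[OF gauge_Int[OF \<gamma>1(1) \<gamma>2(1)] \<gamma>3(1)]] by metis
  have part: "p tagged_partial_division_of cbox a b"
    using p(1) by (auto simp: tagged_division_of_def)
  have fine: "\<gamma>1 fine p" "\<gamma>2 fine p" "\<gamma>3 fine p" using p(2) by (auto simp: fine_def)
  have "\<bar>F b - F a\<bar> = \<bar>\<Sum>(x, K)\<in>p. F (Sup K) - F (Inf K)\<bar>"
    using additive_tagged_division_1[OF ab p(1), of F] by simp
  also have "\<dots> \<le> (\<Sum>(x, K)\<in>p. \<bar>F (Sup K) - F (Inf K)\<bar>)"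
    by (rule order_trans[OF sum_abs]) (auto intro!: sum_mono)
  also have "\<dots> \<le> (\<Sum>z\<in>p. (case z of (x, K) \<Rightarrow> integral K ?m) + err g z + err h z + err ?m z)"
  proof (rule sum_mono)
    fix z assume z: "z \<in> p"
    obtain x K where zxK: "z = (x, K)" by (cases z)
    with z have xK: "(x, K) \<in> p" by simp
    obtain u v where K: "K = {u..v}" "u \<le> v" "a \<le> u" "v \<le> b"
      using tagged_division_ofD(2-4)[OF p(1) xK] by (metis atLeastAtMost_iff atLeastatMost_subset_iff box_real(2) order_trans)
    have F: "\<bar>F (Sup K) - F (Inf K)\<bar> \<le> integral K g" "\<bar>F (Sup K) - F (Inf K)\<bar> \<le> integral K h"
      using K Fg[of u v] Fh[of u v] by simp_all
    \<comment> \<open>Here \<open>i\<close>, \<open>j\<close>, \<open>M\<close> are the integrals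
      over the piece of \<open>g\<close>, \<open>h\<close> and the minimum, while \<open>A\<close>,
      \<open>B\<close>, \<open>C\<close> are its length times their values at the tag. If
      \<open>C = A\<close>, then \<open>d\<close> is compared with \<open>i\<close>, then
      \<open>A\<close>, then \<open>M\<close>; if \<open>C = B\<close>, the route is through
      \<open>j\<close> and \<open>B\<close>.\<close>
    have tri: "\<bar>d\<bar> \<le> M + \<bar>A - i\<bar> + \<bar>B - j\<bar> + \<bar>C - M\<bar>"
      if "\<bar>d\<bar> \<le> i" "\<bar>d\<bar> \<le> j" "C = A \<or> C = B" for d A B C i j M :: real
      using that by linarith
    show "(case z of (x, K) \<Rightarrow> \<bar>F (Sup K) - F (Inf K)\<bar>) \<le> (case z of (x, K) \<Rightarrow> integral K ?m)
        + err g z + err h z + err ?m z"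
      unfolding err_def zxK split_conv real_norm_def
      by (rule tri[OF F]) (auto simp: min_def)
  qed
  also have "\<dots> = (\<Sum>(x, K)\<in>p. integral K ?m) + sum (err g) p + sum (err h) p + sum (err ?m) p"
    by (simp add: sum.distrib)
  also have "(\<Sum>(x, K)\<in>p. integral K ?m) = integral {a..b} ?m"
    using integral_combine_tagged_division_topdown[OF m[folded box_real(2)], of p] p(1) by simp
  also have "integral {a..b} ?m + sum (err g) p + sum (err h) p + sum (err ?m) p \<le> integral {a..b} ?m + e"
    using \<gamma>1(2)[OF part fine(1)] \<gamma>2(2)[OF part fine(2)] \<gamma>3(2)[OF part fine(3)] by simp
  finally show "\<bar>F b - F a\<bar> \<le> integral {a..b} ?m + e" .
qed

text \<open>A finite integral forces \<open>G\<close> to be finite almost everywhere, so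
  \<open>enn2real\<close> changes it only on a null set. This links curve integrals with the gauge
  integral of Henstock's lemma.\<close>

lemma nn_integral_lebesgue_on_eq_integral:
  fixes G :: "real \<Rightarrow> ennreal"
  assumes "G \<in> borel_measurable (lebesgue_on {a..b})"
    and "(\<integral>\<^sup>+ x. G x \<partial>lebesgue_on {a..b}) < \<infinity>"
  shows "(\<lambda>x. enn2real (G x)) integrable_on {a..b}"
    and "(\<integral>\<^sup>+ x. G x \<partial>lebesgue_on {a..b}) = ennreal (integral {a..b} (\<lambda>x. enn2real (G x)))"
proof -
  note [measurable] = assms(1)
  have "AE x in lebesgue_on {a..b}. G x \<noteq> \<infinity>"
    using assms by (intro nn_integral_PInf_AE) auto
  then have eq: "(\<integral>\<^sup>+ x. G x \<partial>lebesgue_on {a..b}) = (\<integral>\<^sup>+ x. ennreal (enn2real (G x)) \<partial>lebesgue_on {a..b})"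
    by (intro nn_integral_cong_AE) (auto simp: less_top)
  have int: "integrable (lebesgue_on {a..b}) (\<lambda>x. enn2real (G x))"
    using assms eq by (intro integrableI_nonneg) auto
  then show "(\<lambda>x. enn2real (G x)) integrable_on {a..b}"
    by (intro integrable_on_lebesgue_on) auto
  show "(\<integral>\<^sup>+ x. G x \<partial>lebesgue_on {a..b}) = ennreal (integral {a..b} (\<lambda>x. enn2real (G x)))"
    using int unfolding eq
    by (subst nn_integral_eq_integral) (auto simp: lebesgue_integral_eq_integral)
qed

lemma borel_measurable_lebesgue_on_subinterval:
  fixes G :: "real \<Rightarrow> ennreal"
  assumes "G \<in> borel_measurable (lebesgue_on {a..b})" "{s..t} \<subseteq> {a..b}"
  shows "G \<in> borel_measurable (lebesgue_on {s..t})"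
  using measurable_restrict_mono[OF assms] .

lemma nn_integral_lebesgue_on_mono_set:
  fixes G :: "real \<Rightarrow> ennreal"
  assumes "{s..t} \<subseteq> {a..b}"
  shows "(\<integral>\<^sup>+ x. G x \<partial>lebesgue_on {s..t}) \<le> (\<integral>\<^sup>+ x. G x \<partial>lebesgue_on {a..b})"
proof -
  have "(\<integral>\<^sup>+ x. G x * indicator {s..t} x \<partial>lebesgue) \<le> (\<integral>\<^sup>+ x. G x * indicator {a..b} x \<partial>lebesgue)"
    using assms by (intro nn_integral_mono) (auto simp: indicator_def)
  then show ?thesis by (simp add: nn_integral_restrict_space)
qed

text \<open>The inequality can be strict because \<open>enn2real\<close> sends infinity to 0; for
  bounding increments from above this direction suffices.\<close>

lemma ennreal_min_enn2real_le: "ennreal (min (enn2real a) (enn2real b)) \<le> min a b"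
  by (cases a; cases b) (auto simp: min_def ennreal_leI)

lemma abs_increment_le_nn_integral_min:
  fixes F :: "real \<Rightarrow> real" and G H :: "real \<Rightarrow> ennreal"
  assumes ab: "a \<le> b"
    and G: "G \<in> borel_measurable (lebesgue_on {a..b})" "(\<integral>\<^sup>+ x. G x \<partial>lebesgue_on {a..b}) < \<infinity>"
    and H: "H \<in> borel_measurable (lebesgue_on {a..b})" "(\<integral>\<^sup>+ x. H x \<partial>lebesgue_on {a..b}) < \<infinity>"
    and FG: "\<And>s t. a \<le> s \<Longrightarrow> s < t \<Longrightarrow> t \<le> b \<Longrightarrow>
      ennreal \<bar>F s - F t\<bar> \<le> (\<integral>\<^sup>+ x. G x \<partial>lebesgue_on {s..t})"
    and FH: "\<And>s t. a \<le> s \<Longrightarrow> s < t \<Longrightarrow> t \<le> b \<Longrightarrow>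
      ennreal \<bar>F s - F t\<bar> \<le> (\<integral>\<^sup>+ x. H x \<partial>lebesgue_on {s..t})"
  shows "ennreal \<bar>F a - F b\<bar> \<le> (\<integral>\<^sup>+ x. min (G x) (H x) \<partial>lebesgue_on {a..b})"
proof -
  note [measurable] = G(1) H(1)
  let ?M = "\<lambda>x. min (G x) (H x)"
  let ?g = "\<lambda>x. enn2real (G x)" and ?h = "\<lambda>x. enn2real (H x)"
  have incr: "\<bar>F t - F s\<bar> \<le> integral {s..t} (\<lambda>x. enn2real (K x))"
    if K: "K \<in> borel_measurable (lebesgue_on {a..b})" "(\<integral>\<^sup>+ x. K x \<partial>lebesgue_on {a..b}) < \<infinity>"
      and FK: "s < t \<Longrightarrow> ennreal \<bar>F s - F t\<bar> \<le> (\<integral>\<^sup>+ x. K x \<partial>lebesgue_on {s..t})"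
      and st: "a \<le> s" "s \<le> t" "t \<le> b" for K s t
  proof (cases "s = t")
    case False
    have sub: "{s..t} \<subseteq> {a..b}" using st by auto
    note K' = borel_measurable_lebesgue_on_subinterval[OF K(1) sub]
      le_less_trans[OF nn_integral_lebesgue_on_mono_set[OF sub] K(2)]
    \<comment> \<open>Nonnegativity of the right-hand side permits cancelling \<open>ennreal\<close>
      from the inequality.\<close>
    have "0 \<le> integral {s..t} (\<lambda>x. enn2real (K x))"
      by (intro integral_nonneg nn_integral_lebesgue_on_eq_integral(1)[OF K']) auto
    then show ?thesis
      using FK False st nn_integral_lebesgue_on_eq_integral(2)[OF K']
      by (simp add: abs_minus_commute)
  qed simp
  have int: "integrable (lebesgue_on {a..b}) (\<lambda>x. min (?g x) (?h x))"
  proof -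
    have "(\<integral>\<^sup>+ x. ennreal (min (?g x) (?h x)) \<partial>lebesgue_on {a..b}) \<le> (\<integral>\<^sup>+ x. G x \<partial>lebesgue_on {a..b})"
      by (intro nn_integral_mono order_trans[OF ennreal_min_enn2real_le]) simp
    then show ?thesis
      using G(2) by (intro integrableI_nonneg) auto
  qed
  then have m: "(\<lambda>x. min (?g x) (?h x)) integrable_on {a..b}"
    by (intro integrable_on_lebesgue_on) auto
  have "\<bar>F b - F a\<bar> \<le> integral {a..b} (\<lambda>x. min (?g x) (?h x))"
    by (rule abs_increment_le_integral_min[OF ab nn_integral_lebesgue_on_eq_integral(1)[OF G]
        nn_integral_lebesgue_on_eq_integral(1)[OF H] m])
      (use incr[OF G] incr[OF H] FG FH in auto)
  then have "ennreal \<bar>F a - F b\<bar> \<le> ennreal (integral {a..b} (\<lambda>x. min (?g x) (?h x)))"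
    by (simp add: ennreal_leI abs_minus_commute)
  also have "\<dots> = (\<integral>\<^sup>+ x. ennreal (min (?g x) (?h x)) \<partial>lebesgue_on {a..b})"
    using int by (subst nn_integral_eq_integral) (auto simp: lebesgue_integral_eq_integral)
  also have "\<dots> \<le> (\<integral>\<^sup>+ x. ?M x \<partial>lebesgue_on {a..b})"
    by (intro nn_integral_mono) (rule ennreal_min_enn2real_le)
  finally show ?thesis .
qed

section \<open>Minima and decreasing limits of weak upper gradients\<close>

lemma ereal_diff_abs_finite:
  assumes "ereal_diff_abs a b < \<infinity>"
  shows "\<bar>a\<bar> \<noteq> \<infinity>" "\<bar>b\<bar> \<noteq> \<infinity>"
  using assms by (auto simp: ereal_diff_abs_def split: if_splits)

lemma ereal_diff_abs_eq:
  assumes "\<bar>a\<bar> \<noteq> \<infinity>" "\<bar>b\<bar> \<noteq> \<infinity>"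
  shows "ereal_diff_abs a b = ennreal \<bar>real_of_ereal a - real_of_ereal b\<bar>"
  using assms by (cases a; cases b) (auto simp: ereal_diff_abs_def)

text \<open>On almost every curve both gradients have finite integrals and bound the increments of
  \<open>f\<close> over all subcurves. There \<open>f\<close> is finite along the curve, and the
  interval estimate for the minimum applies.\<close>

lemma weak_upper_gradient_min:
  assumes p: "0 < p" and g: "weak_upper_gradient \<mu> p f g" "in_Lp \<mu> p g"
    and h: "weak_upper_gradient \<mu> p f h" "in_Lp \<mu> p h"
  shows "weak_upper_gradient \<mu> p f (\<lambda>x. min (g x) (h x))"
proof -
  \<comment> \<open>The bound is demanded on every subinterval, since the smaller of the two
    gradients may change along the curve.\<close>
  define W where "W g \<gamma> l \<longleftrightarrow> curve_integral \<gamma> l g < \<infinity> \<and>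
    (\<lambda>t. g (\<gamma> t)) \<in> borel_measurable (lebesgue_on {0..l}) \<and>
    (\<forall>s t. 0 \<le> s \<and> s < t \<and> t \<le> l \<longrightarrow>
      ereal_diff_abs (f (\<gamma> s)) (f (\<gamma> t)) \<le> (\<integral>\<^sup>+ x. g (\<gamma> x) \<partial>lebesgue_on {s..t}))"
    for g \<gamma> l
  have W: "almost_every_curve \<mu> p (W k)"
    if "weak_upper_gradient \<mu> p f k" "in_Lp \<mu> p k" for k
  proof -
    have "almost_every_curve \<mu> p (\<lambda>\<gamma> l. ereal_diff_abs (f (\<gamma> 0)) (f (\<gamma> l)) \<le> curve_integral \<gamma> l k)"
      using that(1) unfolding weak_upper_gradient_def by (auto elim: almost_every_curve_mono)
    from almost_every_curve_subcurves[OF this]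
    have "almost_every_curve \<mu> p (\<lambda>\<gamma> l. \<forall>s t. 0 \<le> s \<and> s < t \<and> t \<le> l \<longrightarrow>
      ereal_diff_abs (f (\<gamma> s)) (f (\<gamma> t)) \<le> (\<integral>\<^sup>+ x. k (\<gamma> x) \<partial>lebesgue_on {s..t}))"
      by (simp add: curve_integral_subcurve)
    moreover have "almost_every_curve \<mu> p (\<lambda>\<gamma> l. (\<lambda>t. k (\<gamma> t)) \<in> borel_measurable (lebesgue_on {0..l}))"
      using that(1) unfolding weak_upper_gradient_def by (auto elim: almost_every_curve_mono)
    ultimately show ?thesis
      using almost_every_curve_finite_integral[OF that(2)] unfolding W_def
      by (intro almost_every_curve_conj p)
  qed
  have "almost_every_curve \<mu> p (\<lambda>\<gamma> l. W g \<gamma> l \<and> W h \<gamma> l)"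
    by (intro almost_every_curve_conj p W g h)
  then have "almost_every_curve \<mu> p (\<lambda>\<gamma> l.
       (\<lambda>t. min (g (\<gamma> t)) (h (\<gamma> t))) \<in> borel_measurable (lebesgue_on {0..l}) \<and>
       ereal_diff_abs (f (\<gamma> 0)) (f (\<gamma> l)) \<le> curve_integral \<gamma> l (\<lambda>x. min (g x) (h x)))"
  proof (rule almost_every_curve_mono)
    fix \<gamma> :: "real \<Rightarrow> 'a" and l assume "arclength_curve \<gamma> l" and WW: "W g \<gamma> l \<and> W h \<gamma> l"
    then have l: "0 < l" by (simp add: arclength_curve_def)
    note [measurable] = WW[unfolded W_def, THEN conjunct1, THEN conjunct2, THEN conjunct1]
      WW[unfolded W_def, THEN conjunct2, THEN conjunct2, THEN conjunct1]
    have incr: "ereal_diff_abs (f (\<gamma> s)) (f (\<gamma> t)) \<le> (\<integral>\<^sup>+ x. k (\<gamma> x) \<partial>lebesgue_on {s..t})"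
      if "k = g \<or> k = h" "0 \<le> s" "s < t" "t \<le> l" for s t k
      using WW that unfolding W_def by blast
    have fin: "(\<integral>\<^sup>+ x. k (\<gamma> x) \<partial>lebesgue_on {0..l}) < \<infinity>" if "k = g \<or> k = h" for k
      using WW that unfolding W_def curve_integral_def by blast
    \<comment> \<open>\<open>ereal_diff_abs\<close> is infinite as soon as one value of
      \<open>f\<close> is, so a finite bound on \<open>[0, s]\<close> makes \<open>f\<close> finite
      at both ends. The starting point itself is covered by taking \<open>s = l\<close>.\<close>
    have finite0: "ereal_diff_abs (f (\<gamma> 0)) (f (\<gamma> s)) < \<infinity>" if "0 < s" "s \<le> l" for s
      using incr[of g 0 s] nn_integral_lebesgue_on_mono_set[of 0 s 0 l "\<lambda>x. g (\<gamma> x)"] fin[of g] that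
      by (auto intro: le_less_trans)
    have finite: "\<bar>f (\<gamma> s)\<bar> \<noteq> \<infinity>" if "0 \<le> s" "s \<le> l" for s
      using ereal_diff_abs_finite[OF finite0, of s] ereal_diff_abs_finite[OF finite0, of l] l that
      by (cases "s = 0") auto
    have eq: "ereal_diff_abs (f (\<gamma> s)) (f (\<gamma> t)) =
        ennreal \<bar>real_of_ereal (f (\<gamma> s)) - real_of_ereal (f (\<gamma> t))\<bar>"
      if "0 \<le> s" "s \<le> t" "t \<le> l" for s t
      using that by (intro ereal_diff_abs_eq finite) auto
    have "ennreal \<bar>real_of_ereal (f (\<gamma> 0)) - real_of_ereal (f (\<gamma> l))\<bar>
        \<le> (\<integral>\<^sup>+ x. min (g (\<gamma> x)) (h (\<gamma> x)) \<partial>lebesgue_on {0..l})"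
      using l fin incr[of g] incr[of h] eq
      by (intro abs_increment_le_nn_integral_min[where F="\<lambda>t. real_of_ereal (f (\<gamma> t))"]) auto
    then show "(\<lambda>t. min (g (\<gamma> t)) (h (\<gamma> t))) \<in> borel_measurable (lebesgue_on {0..l}) \<and>
       ereal_diff_abs (f (\<gamma> 0)) (f (\<gamma> l)) \<le> curve_integral \<gamma> l (\<lambda>x. min (g x) (h x))"
      using l eq[of 0 l] unfolding curve_integral_def by simp
  qed
  then show ?thesis using g(1) h(1) unfolding weak_upper_gradient_def by auto
qed

lemma in_Lp_mono:
  assumes "0 \<le> p" "in_Lp \<mu> p h" "g \<in> borel_measurable \<mu>" "\<And>x. g x \<le> h x"
  shows "in_Lp \<mu> p g"
proof -
  have "(\<integral>\<^sup>+ x. ennpowr (g x) p \<partial>\<mu>) \<le> (\<integral>\<^sup>+ x. ennpowr (h x) p \<partial>\<mu>)"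
    by (intro nn_integral_mono ennpowr_mono assms)
  with assms show ?thesis unfolding in_Lp_def by (auto intro: le_less_trans)
qed

text \<open>Monotone convergence for a decreasing sequence needs a finite integral at the start;
  \<open>m 0\<close> in \<open>L^p\<close> provides it on almost every curve. The bounds for the
  individual \<open>m n\<close> then pass to the infimum.\<close>

lemma weak_upper_gradient_INF:
  assumes p: "0 < p" and dec: "decseq m" and Lp: "in_Lp \<mu> p (m 0)"
    and m: "\<And>n::nat. weak_upper_gradient \<mu> p f (m n)"
  shows "weak_upper_gradient \<mu> p f (\<lambda>x. INF n. m n x)"
proof -
  have [measurable]: "m n \<in> borel_measurable \<mu>" for n
    using m by (simp add: weak_upper_gradient_def)
  have "almost_every_curve \<mu> p (\<lambda>\<gamma> l. \<forall>n. (\<lambda>t. m n (\<gamma> t)) \<in> borel_measurable (lebesgue_on {0..l}) \<and>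
       ereal_diff_abs (f (\<gamma> 0)) (f (\<gamma> l)) \<le> curve_integral \<gamma> l (m n))"
    by (rule almost_every_curve_all_countable[OF p]) (use m in \<open>simp add: weak_upper_gradient_def\<close>)
  then have "almost_every_curve \<mu> p (\<lambda>\<gamma> l. (\<forall>n. (\<lambda>t. m n (\<gamma> t)) \<in> borel_measurable (lebesgue_on {0..l}) \<and>
       ereal_diff_abs (f (\<gamma> 0)) (f (\<gamma> l)) \<le> curve_integral \<gamma> l (m n)) \<and> curve_integral \<gamma> l (m 0) < \<infinity>)"
    by (intro almost_every_curve_conj almost_every_curve_finite_integral p Lp)
  then have "almost_every_curve \<mu> p (\<lambda>\<gamma> l.
       (\<lambda>t. INF n. m n (\<gamma> t)) \<in> borel_measurable (lebesgue_on {0..l}) \<and>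
       ereal_diff_abs (f (\<gamma> 0)) (f (\<gamma> l)) \<le> curve_integral \<gamma> l (\<lambda>x. INF n. m n x))"
  proof (rule almost_every_curve_mono)
    fix \<gamma> :: "real \<Rightarrow> 'a" and l
    assume *: "(\<forall>n. (\<lambda>t. m n (\<gamma> t)) \<in> borel_measurable (lebesgue_on {0..l}) \<and>
       ereal_diff_abs (f (\<gamma> 0)) (f (\<gamma> l)) \<le> curve_integral \<gamma> l (m n)) \<and> curve_integral \<gamma> l (m 0) < \<infinity>"
    then have [measurable]: "(\<lambda>t. m n (\<gamma> t)) \<in> borel_measurable (lebesgue_on {0..l})" for n
      by blast
    have "curve_integral \<gamma> l (\<lambda>x. INF n. m n x) = (INF n. curve_integral \<gamma> l (m n))"
      unfolding curve_integral_def using * dec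
      by (intro nn_integral_monotone_convergence_INF_decseq[where i=0])
        (auto simp: curve_integral_def monotone_def le_fun_def)
    then show "(\<lambda>t. INF n. m n (\<gamma> t)) \<in> borel_measurable (lebesgue_on {0..l}) \<and>
       ereal_diff_abs (f (\<gamma> 0)) (f (\<gamma> l)) \<le> curve_integral \<gamma> l (\<lambda>x. INF n. m n x)"
      using * by (auto intro!: INF_greatest)
  qed
  then show ?thesis unfolding weak_upper_gradient_def by auto
qed

section \<open>Existence of minimal weak upper gradients\<close>

theorem minimal_weak_upper_gradient_exists:
  assumes p: "0 < p" and g0: "weak_upper_gradient \<mu> p f g0" "in_Lp \<mu> p g0"
  shows "\<exists>g. is_minimal_weak_upper_gradient \<mu> p f g"
proof -
  define S where "S = {g. weak_upper_gradient \<mu> p f g \<and> in_Lp \<mu> p g}"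
  define E where "E g = (\<integral>\<^sup>+ x. ennpowr (g x) p \<partial>\<mu>)" for g
  have E_mono: "E g \<le> E h" if "\<And>x. g x \<le> h x" for g h
    unfolding E_def using p that by (intro nn_integral_mono ennpowr_mono) auto
  have S_min: "(\<lambda>x. min (g x) (h x)) \<in> S" if "g \<in> S" "h \<in> S" for g h
  proof -
    have "weak_upper_gradient \<mu> p f (\<lambda>x. min (g x) (h x))"
      using that p by (auto simp: S_def intro: weak_upper_gradient_min)
    then show ?thesis
      using that p unfolding S_def
      by (auto simp: weak_upper_gradient_def intro!: in_Lp_mono[of p \<mu> g])
  qed
  have S_ne: "E ` S \<noteq> {}" using g0 by (auto simp: S_def)
  obtain e where "decseq e \<and> range e \<subseteq> E ` S \<and> Inf (E ` S) = (INF n. e n :: ennreal)"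
    using ennreal_Inf_countable_INF[OF S_ne] by (rule exE)
  then have e: "range e \<subseteq> E ` S" "Inf (E ` S) = (INF n. e n)"
    by (rule conjunct2[THEN conjunct1], rule conjunct2[THEN conjunct2])
  have "\<exists>g. g \<in> S \<and> E g = e n" for n
  proof -
    have "e n \<in> E ` S" by (rule subsetD[OF e(1) rangeI])
    then show ?thesis by (elim imageE) (intro exI conjI, assumption, rule sym)
  qed
  then have "\<exists>g. \<forall>n. g n \<in> S \<and> E (g n) = e n" by (intro choice allI)
  then obtain g where g': "\<forall>n. g n \<in> S \<and> E (g n) = e n" by (rule exE)
  have g: "g n \<in> S" "E (g n) = e n" for n
    using spec[OF g', of n] by (rule conjunct1, rule conjunct2)
  \<comment> \<open>Running minima turn the minimizing sequence into a decreasing one without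
    raising the energies, and they remain competitors by closure under minima.\<close>
  define m where "m = rec_nat (g 0) (\<lambda>n h x. min (h x) (g (Suc n) x))"
  have m_Suc: "m (Suc n) = (\<lambda>x. min (m n x) (g (Suc n) x))" for n by (simp add: m_def)
  have mS: "m n \<in> S" for n
    by (induction n) (auto simp: m_Suc S_min g, simp add: m_def g)
  have m_le: "m n x \<le> g n x" for n x by (cases n) (simp_all add: m_def)
  have dec: "decseq m" by (intro decseq_SucI) (simp add: m_Suc le_fun_def)
  define G where "G x = (INF n. m n x)" for x
  have G_le: "G x \<le> m n x" for n x unfolding G_def by (rule INF_lower) simp
  have wG: "weak_upper_gradient \<mu> p f G"
    unfolding G_def[abs_def] using mS by (intro weak_upper_gradient_INF p dec) (auto simp: S_def)
  have GS: "G \<in> S"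
    using wG mS[of 0] in_Lp_mono[of p \<mu> "m 0" G] G_le p by (auto simp: S_def weak_upper_gradient_def)
  have G_inf: "E G \<le> E h" if "h \<in> S" for h
  proof -
    have "E G \<le> Inf (E ` S)"
      unfolding e(2) g(2)[symmetric] by (intro INF_greatest E_mono order_trans[OF G_le m_le])
    also have "\<dots> \<le> E h" using that by (rule INF_lower)
    finally show ?thesis .
  qed
  have "AE x in \<mu>. G x \<le> h x" if h: "h \<in> S" for h
  proof -
    \<comment> \<open>The minimum is a competitor below \<open>G\<close>, yet its energy cannot be
      smaller. So the nonnegative difference of the \<open>p\<close>-th powers integrates to 0 and
      vanishes almost everywhere.\<close>
    let ?k = "\<lambda>x. min (G x) (h x)"
    have k: "?k \<in> S" by (intro S_min GS h)
    have [measurable]: "G \<in> borel_measurable \<mu>" "h \<in> borel_measurable \<mu>"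
      using GS h by (auto simp: S_def in_Lp_def)
    have finG: "E G < \<infinity>" and fin: "E ?k < \<infinity>" using GS k by (auto simp: S_def in_Lp_def E_def)
    have "(\<integral>\<^sup>+ x. ennpowr (G x) p - ennpowr (?k x) p \<partial>\<mu>) = E G - E ?k"
      unfolding E_def using fin p
      by (intro nn_integral_diff) (auto simp: E_def intro!: ennpowr_mono)
    also have "\<dots> = 0" using G_inf[OF k] finG by (simp add: diff_eq_0_iff_ennreal)
    finally have "AE x in \<mu>. ennpowr (G x) p - ennpowr (?k x) p = 0"
      by (subst (asm) nn_integral_0_iff_AE) auto
    moreover have "AE x in \<mu>. ennpowr (?k x) p \<noteq> \<infinity>"
      using fin unfolding E_def by (intro nn_integral_PInf_AE) auto
    ultimately show ?thesis
    proof eventually_elim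
      case (elim x)
      then have "ennpowr (G x) p \<le> ennpowr (?k x) p"
        by (auto simp: diff_eq_0_iff_ennreal)
      then show ?case using p by (simp add: ennpowr_le_iff)
    qed
  qed
  with GS show ?thesis unfolding is_minimal_weak_upper_gradient_def S_def by blast
qed

text \<open>Existence guarantees that the representative picked by \<open>SOME\<close> really is
  minimal, hence comparable with every competitor.\<close>

lemma minimal_weak_upper_gradient_le:
  assumes "0 < p" "weak_upper_gradient \<mu> p f g" "in_Lp \<mu> p g"
  shows "AE x in \<mu>. minimal_weak_upper_gradient \<mu> p f x \<le> g x"
  using someI_ex[OF minimal_weak_upper_gradient_exists[OF assms]] assms(2,3)
  unfolding minimal_weak_upper_gradient_def[symmetric] by (simp add: is_minimal_weak_upper_gradient_def)

section \<open>Upper gradients and the radial cutoff function\<close>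

text \<open>No curve is exceptional, so \<rho> = 0 is a witness; measurability along curves comes
  from \<open>g\<close> being Borel.\<close>

lemma upper_gradient_imp_weak_upper_gradient:
  assumes "sets borel \<subseteq> sets \<mu>" "space \<mu> = UNIV" "upper_gradient f g"
  shows "weak_upper_gradient \<mu> p f g"
proof -
  have "g \<in> borel_measurable \<mu>"
    using assms by (auto simp: upper_gradient_def measurable_def)
  moreover have "almost_every_curve \<mu> p (\<lambda>\<gamma> l.
       (\<lambda>t. g (\<gamma> t)) \<in> borel_measurable (lebesgue_on {0..l}) \<and>
       ereal_diff_abs (f (\<gamma> 0)) (f (\<gamma> l)) \<le> curve_integral \<gamma> l g)"
    using assms(3) unfolding almost_every_curve_def exceptional_family_def
    by (intro exI[of _ "\<lambda>_. 0"])
      (auto simp: in_Lp_def ennpowr_def upper_gradient_def arclength_curve_measurable)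
  ultimately show ?thesis unfolding weak_upper_gradient_def by (rule conjI)
qed

text \<open>Take \<open>t\<close> as the first time at which \<phi> reaches \<open>B\<close>, and
  \<open>s\<close> as the last time before \<open>t\<close> at which \<phi> is at most
  \<open>A\<close>. Both exist by compactness.\<close>

lemma continuous_crossing_interval:
  fixes \<phi> :: "real \<Rightarrow> real"
  assumes cont: "continuous_on {0..l} \<phi>" and "0 \<le> l" "\<phi> 0 \<le> A" "A < B" "B \<le> \<phi> l"
  obtains s t where "0 \<le> s" "s < t" "t \<le> l" "\<phi> s \<le> A" "B \<le> \<phi> t"
    "\<And>x. s < x \<Longrightarrow> x < t \<Longrightarrow> A < \<phi> x \<and> \<phi> x < B"
proof -
  have compact: "compact ({0..u} \<inter> \<phi> -` S)" if "closed S" "u \<le> l" for u S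
    using compact_Int_closed[OF compact_Icc continuous_closed_preimage[OF
          continuous_on_subset[OF cont] closed_atLeastAtMost that(1)], of 0 u 0 u] that
    by (simp add: Int_assoc[symmetric])
  have ne_B: "{0..l} \<inter> \<phi> -` {B..} \<noteq> {}" using assms(2,5) by auto
  obtain t where t: "t \<in> {0..l} \<inter> \<phi> -` {B..}" "\<And>x. x \<in> {0..l} \<inter> \<phi> -` {B..} \<Longrightarrow> t \<le> x"
    using compact_attains_inf[OF compact[OF closed_atLeast order_refl] ne_B] by blast
  have ne_A: "{0..t} \<inter> \<phi> -` {..A} \<noteq> {}" using assms(3) t(1) by auto
  obtain s where s: "s \<in> {0..t} \<inter> \<phi> -` {..A}" "\<And>x. x \<in> {0..t} \<inter> \<phi> -` {..A} \<Longrightarrow> x \<le> s"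
    using compact_attains_sup[OF compact[OF closed_atMost] ne_A] t(1) by auto
  have "s \<noteq> t" using s(1) t(1) assms by auto
  show thesis
  proof (rule that[of s t])
    show "A < \<phi> x \<and> \<phi> x < B" if "s < x" "x < t" for x
      using s(1) s(2)[of x] t(1) t(2)[of x] that by (auto simp: not_le[symmetric])
  qed (use s(1) t(1) \<open>s \<noteq> t\<close> in auto)
qed

text \<open>Apply the crossing interval with \<open>A = max r (\<phi> 0)\<close> and
  \<open>B = min R (\<phi> l)\<close>. If \<open>A < B\<close>, the clamped increment is
  \<open>B - A\<close>, at most the length of that interval by the Lipschitz bound, and \<phi> stays
  strictly between \<open>r\<close> and \<open>R\<close> inside it. Otherwise the clamped values at
  the ends agree.\<close>

lemma clamped_increment_le_measure_if_le:
  fixes \<phi> :: "real \<Rightarrow> real"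
  assumes l: "0 < l" and lip: "\<And>s t. 0 \<le> s \<Longrightarrow> s \<le> t \<Longrightarrow> t \<le> l \<Longrightarrow> \<bar>\<phi> t - \<phi> s\<bar> \<le> t - s"
    and rR: "r < R" and incr: "\<phi> 0 \<le> \<phi> l"
  shows "ennreal \<bar>max r (min R (\<phi> l)) - max r (min R (\<phi> 0))\<bar>
    \<le> (\<integral>\<^sup>+ t. indicator {r<..<R} (\<phi> t) \<partial>lebesgue_on {0..l})"
proof (cases "max r (\<phi> 0) < min R (\<phi> l)")
  case True
  have cont: "continuous_on {0..l} \<phi>"
    using lip by (intro continuous_on_dist_le) (simp add: dist_real_def abs_minus_commute)
  obtain s t where st: "0 \<le> s" "s < t" "t \<le> l" "\<phi> s \<le> max r (\<phi> 0)" "min R (\<phi> l) \<le> \<phi> t"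
    "\<And>x. s < x \<Longrightarrow> x < t \<Longrightarrow> max r (\<phi> 0) < \<phi> x \<and> \<phi> x < min R (\<phi> l)"
    using continuous_crossing_interval[OF cont less_imp_le[OF l] _ True] by auto
  have "\<bar>max r (min R (\<phi> l)) - max r (min R (\<phi> 0))\<bar> \<le> t - s"
    using lip[of s t] st(1-5) True rR by (auto simp: max_def min_def split: if_splits)
  then have "ennreal \<bar>max r (min R (\<phi> l)) - max r (min R (\<phi> 0))\<bar> \<le> emeasure lebesgue {s<..<t}"
    using st by (simp add: ennreal_leI)
  also have "\<dots> = (\<integral>\<^sup>+ x. indicator {s<..<t} x \<partial>lebesgue)" by simp
  also have "\<dots> \<le> (\<integral>\<^sup>+ x. indicator {r<..<R} (\<phi> x) * indicator {0..l} x \<partial>lebesgue)"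
    using st by (intro nn_integral_mono) (force simp: indicator_def)
  also have "\<dots> = (\<integral>\<^sup>+ t. indicator {r<..<R} (\<phi> t) \<partial>lebesgue_on {0..l})"
    by (simp add: nn_integral_restrict_space)
  finally show ?thesis .
next
  case False
  then have "max r (min R (\<phi> l)) = max r (min R (\<phi> 0))"
    using incr rR by (auto simp: max_def min_def split: if_splits)
  then show ?thesis by simp
qed

lemma clamped_increment_le_measure:
  fixes \<phi> :: "real \<Rightarrow> real"
  assumes l: "0 < l" and lip: "\<And>s t. 0 \<le> s \<Longrightarrow> s \<le> t \<Longrightarrow> t \<le> l \<Longrightarrow> \<bar>\<phi> t - \<phi> s\<bar> \<le> t - s"
    and rR: "r < R"
  shows "ennreal \<bar>max r (min R (\<phi> l)) - max r (min R (\<phi> 0))\<bar>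
    \<le> (\<integral>\<^sup>+ t. indicator {r<..<R} (\<phi> t) \<partial>lebesgue_on {0..l})"
proof (cases "\<phi> 0 \<le> \<phi> l")
  case True then show ?thesis using clamped_increment_le_measure_if_le assms by blast
next
  case False
  \<comment> \<open>Reflection to \<open>- \<phi>\<close> with the levels \<open>- R\<close> and
    \<open>- r\<close> reduces the decreasing case to the increasing one.\<close>
  have "ennreal \<bar>max (- R) (min (- r) (- \<phi> l)) - max (- R) (min (- r) (- \<phi> 0))\<bar>
    \<le> (\<integral>\<^sup>+ t. indicator {- R<..<- r} (- \<phi> t) \<partial>lebesgue_on {0..l})"
    using l rR False lip by (intro clamped_increment_le_measure_if_le) (auto simp: abs_minus_commute)
  moreover have "\<bar>max (- R) (min (- r) (- \<phi> l)) - max (- R) (min (- r) (- \<phi> 0))\<bar>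
      = \<bar>max r (min R (\<phi> l)) - max r (min R (\<phi> 0))\<bar>"
    using rR by (auto simp: max_def min_def)
  moreover have "indicator {- R<..<- r} (- x) = (indicator {r<..<R} x :: ennreal)" for x
    by (auto simp: indicator_def)
  ultimately show ?thesis by simp
qed

text \<open>Clamping the distance to \<open>[r, R]\<close> gives 1 on the inner ball and 0 outside
  the outer one, and reduces increments along curves to those of a clamped 1-Lipschitz
  function.\<close>

definition ball_cutoff :: "'a::metric_space \<Rightarrow> real \<Rightarrow> real \<Rightarrow> 'a \<Rightarrow> ereal" where
  "ball_cutoff x0 r R x = ereal ((R - max r (min R (dist x0 x))) / (R - r))"

text \<open>Along an arc length curve the distance to \<open>x0\<close> is 1-Lipschitz, so the time
  spent in the annulus is at least the change of the clamped distance.\<close>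

lemma upper_gradient_ball_cutoff:
  assumes "r < R"
  shows "upper_gradient (ball_cutoff x0 r R)
    (\<lambda>x. ennreal (1 / (R - r)) * indicator (ball x0 R - ball x0 r) x)"
  unfolding upper_gradient_def
proof (intro conjI allI impI)
  fix \<gamma> :: "real \<Rightarrow> 'a" and l assume \<gamma>: "arclength_curve \<gamma> l"
  let ?\<phi> = "\<lambda>t. dist x0 (\<gamma> t)"
  let ?c = "\<lambda>v. max r (min R v)"
  have lip: "\<bar>?\<phi> t - ?\<phi> s\<bar> \<le> t - s" if "0 \<le> s" "s \<le> t" "t \<le> l" for s t
    using arclength_curve_dist_le[OF \<gamma> that] dist_triangle[of x0 "\<gamma> t" "\<gamma> s"] dist_triangle[of x0 "\<gamma> s" "\<gamma> t"]
    by (simp add: dist_commute abs_le_iff)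
  have l: "0 < l" using \<gamma> by (simp add: arclength_curve_def)
  have "ereal_diff_abs (ball_cutoff x0 r R (\<gamma> 0)) (ball_cutoff x0 r R (\<gamma> l))
      = ennreal (\<bar>?c (?\<phi> l) - ?c (?\<phi> 0)\<bar> / (R - r))"
    using assms by (simp add: ereal_diff_abs_def ball_cutoff_def diff_divide_distrib[symmetric])
  also have "\<dots> = ennreal (1 / (R - r)) * ennreal \<bar>?c (?\<phi> l) - ?c (?\<phi> 0)\<bar>"
    using assms by (simp add: ennreal_mult'[symmetric])
  also have "\<dots> \<le> ennreal (1 / (R - r)) * (\<integral>\<^sup>+ t. indicator {r<..<R} (?\<phi> t) \<partial>lebesgue_on {0..l})"
    by (intro mult_left_mono clamped_increment_le_measure l lip assms) auto
  also have "\<dots> \<le> (\<integral>\<^sup>+ t. ennreal (1 / (R - r)) * indicator {r<..<R} (?\<phi> t) \<partial>lebesgue_on {0..l})"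
    by (rule nn_integral_cmult_le)
  \<comment> \<open>The open annulus \<open>r < d < R\<close> lies in the difference of the balls,
    which also contains the points at distance \<open>r\<close>.\<close>
  also have "\<dots> \<le> curve_integral \<gamma> l (\<lambda>x. ennreal (1 / (R - r)) * indicator (ball x0 R - ball x0 r) x)"
    unfolding curve_integral_def by (intro nn_integral_mono mult_left_mono) (auto simp: indicator_def)
  finally show "ereal_diff_abs (ball_cutoff x0 r R (\<gamma> 0)) (ball_cutoff x0 r R (\<gamma> l))
    \<le> curve_integral \<gamma> l (\<lambda>x. ennreal (1 / (R - r)) * indicator (ball x0 R - ball x0 r) x)" .
next
  have [measurable]: "ball x0 s \<in> sets borel" for s by simp
  show "(\<lambda>x. ennreal (1 / (R - r)) * indicator (ball x0 R - ball x0 r) x) \<in> borel_measurable borel"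
    by measurable
qed

section \<open>Capacity estimates for concentric balls\<close>

context metric_measure_space
begin

lemma variational_capacity_ball_le:
  assumes p: "1 \<le> p" and rR: "0 < r" "r < R"
  shows "variational_capacity \<mu> p (ball x0 r) (ball x0 R)
    \<le> ennreal ((1 / (R - r)) powr p * measure \<mu> (ball x0 R - ball x0 r))"
proof -
  let ?u = "ball_cutoff x0 r R"
  let ?g = "\<lambda>x. ennreal (1 / (R - r)) * indicator (ball x0 R - ball x0 r) x"
  have [measurable]: "ball x s \<in> sets \<mu>" for x s
    using borel_sets_subset by (auto intro: open_ball)
  have fin: "emeasure \<mu> (ball x0 R) < \<infinity>" using ball_finite rR by auto
  have finA: "emeasure \<mu> (ball x0 R - ball x0 r) < \<infinity>"
    by (rule le_less_trans[OF emeasure_mono fin]) auto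
  have g_p: "ennpowr (?g x) p = ennreal ((1 / (R - r)) powr p) * indicator (ball x0 R - ball x0 r) x" for x
    using p rR by (simp add: ennpowr_def indicator_def)
  have int_g: "(\<integral>\<^sup>+ x. ennpowr (?g x) p \<partial>\<mu>)
      = ennreal ((1 / (R - r)) powr p * measure \<mu> (ball x0 R - ball x0 r))"
    unfolding g_p using finA
    by (simp add: nn_integral_cmult emeasure_eq_ennreal_measure ennreal_mult)
  have ug: "upper_gradient ?u ?g" using rR by (intro upper_gradient_ball_cutoff)
  have wug: "weak_upper_gradient \<mu> p ?u ?g"
    by (rule upper_gradient_imp_weak_upper_gradient[OF borel_sets_subset space_eq_UNIV ug])
  have Lp: "in_Lp \<mu> p ?g"
    using wug int_g by (simp add: in_Lp_def weak_upper_gradient_def)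
  have "continuous_on UNIV (\<lambda>x. (R - max r (min R (dist x0 x))) / (R - r))"
    using rR by (intro continuous_intros) auto
  then have "?u \<in> borel_measurable borel"
    unfolding ball_cutoff_def[abs_def]
    by (intro borel_measurable_ereal borel_measurable_continuous_onI)
  then have u_meas: "?u \<in> borel_measurable \<mu>"
    using borel_sets_subset space_eq_UNIV by (auto simp: measurable_def)
  have u1: "?u x \<le> 1" "0 \<le> ?u x" for x using rR by (auto simp: ball_cutoff_def)
  have u0: "?u x = 0" if "x \<notin> ball x0 R" for x using that rR by (auto simp: ball_cutoff_def)
  have u_one: "?u x = 1" if "x \<in> ball x0 r" for x
    using that rR by (auto simp: ball_cutoff_def one_ereal_def)
  \<comment> \<open>The cutoff has values in \<open>[0, 1]\<close> and vanishes outside the outer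
    ball, whose measure is finite.\<close>
  have "(\<integral>\<^sup>+ x. ennpowr (e2ennreal \<bar>?u x\<bar>) p \<partial>\<mu>) \<le> (\<integral>\<^sup>+ x. indicator (ball x0 R) x \<partial>\<mu>)"
  proof (intro nn_integral_mono)
    fix x
    have "ennpowr (e2ennreal \<bar>?u x\<bar>) p \<le> ennpowr 1 p"
      using p u1[of x] e2ennreal_mono[of "?u x" 1] by (intro ennpowr_mono) (auto simp: one_ereal_def)
    then show "ennpowr (e2ennreal \<bar>?u x\<bar>) p \<le> indicator (ball x0 R) x"
      using u0[of x] by (cases "x \<in> ball x0 R") (auto simp: ennpowr_def e2ennreal_neg)
  qed
  also have "\<dots> < \<infinity>" using fin by simp
  finally have "(\<integral>\<^sup>+ x. ennpowr (e2ennreal \<bar>?u x\<bar>) p \<partial>\<mu>) < \<infinity>" .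
  moreover have "(INF g \<in> {g. upper_gradient ?u g}. \<integral>\<^sup>+ x. ennpowr (g x) p \<partial>\<mu>) < \<infinity>"
  proof (rule le_less_trans[OF INF_lower])
    show "?g \<in> {g. upper_gradient ?u g}" using ug by simp
    show "(\<integral>\<^sup>+ x. ennpowr (?g x) p \<partial>\<mu>) < \<infinity>" unfolding int_g by simp
  qed
  ultimately have "?u \<in> newtonian_space \<mu> p"
    using u_meas unfolding newtonian_space_def newtonian_norm_def ennpowr_less_top_iff by simp
  then have "variational_capacity \<mu> p (ball x0 r) (ball x0 R)
      \<le> (\<integral>\<^sup>+ x\<in>ball x0 R. ennpowr (minimal_weak_upper_gradient \<mu> p ?u x) p \<partial>\<mu>)"
    unfolding variational_capacity_def using u0 u1 u_one
    by (intro INF_lower) (auto simp: indicator_def)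
  \<comment> \<open>Comparison almost everywhere is enough, so the choice of the representative does
    not affect the bound.\<close>
  also have "\<dots> \<le> (\<integral>\<^sup>+ x. ennpowr (?g x) p \<partial>\<mu>)"
  proof (rule nn_integral_mono_AE)
    have "AE x in \<mu>. minimal_weak_upper_gradient \<mu> p ?u x \<le> ?g x"
      using p by (intro minimal_weak_upper_gradient_le wug Lp) auto
    then show "AE x in \<mu>. ennpowr (minimal_weak_upper_gradient \<mu> p ?u x) p * indicator (ball x0 R) x
        \<le> ennpowr (?g x) p"
    proof eventually_elim
      case (elim x)
      then have "ennpowr (minimal_weak_upper_gradient \<mu> p ?u x) p \<le> ennpowr (?g x) p"
        using p by (intro ennpowr_mono) auto
      then show ?case by (auto simp: indicator_def)
    qed
  qed
  finally show ?thesis unfolding int_g .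
qed

text \<open>Since \<open>R - r = (1 - r / R) * R\<close>, the factor from the gradient supplies the
  exponent \<open>- p\<close> and the power of \<open>R\<close>, and decay supplies \<eta>.
  Replacing \<open>C\<close> by \<open>max C 1\<close> secures a positive constant, which the decay
  property alone does not state.\<close>

lemma variational_capacity_ball_le_annular_decay:
  assumes p: "1 \<le> p" and AD: "annular_decay_with \<mu> \<eta> C x0" and rR: "0 < r" "r < R"
  shows "variational_capacity \<mu> p (ball x0 r) (ball x0 R)
    \<le> ennreal (max C 1 * (1 - r / R) powr (\<eta> - p) * (measure \<mu> (ball x0 R) / R powr p))"
proof -
  define q where "q = 1 - r / R"
  have q: "0 < q" using rR by (simp add: q_def)
  have "R - r = q * R" using rR by (simp add: q_def field_simps)
  then have pow: "(1 / (R - r)) powr p = 1 / (q powr p * R powr p)"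
    using q rR by (simp add: powr_divide powr_mult)
  have "measure \<mu> (ball x0 R - ball x0 r) \<le> C * q powr \<eta> * measure \<mu> (ball x0 R)"
    using AD rR by (simp add: annular_decay_with_def q_def)
  also have "\<dots> \<le> max C 1 * q powr \<eta> * measure \<mu> (ball x0 R)"
    by (intro mult_right_mono) auto
  finally have "(1 / (R - r)) powr p * measure \<mu> (ball x0 R - ball x0 r)
      \<le> (1 / (R - r)) powr p * (max C 1 * q powr \<eta> * measure \<mu> (ball x0 R))"
    by (intro mult_left_mono) auto
  also have "\<dots> = max C 1 * q powr (\<eta> - p) * (measure \<mu> (ball x0 R) / R powr p)"
    unfolding pow using q by (simp add: powr_diff)
  finally show ?thesis
    using variational_capacity_ball_le[OF p rR] unfolding q_def
    by (meson ennreal_leI order_trans)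
qed

end

theorem proposition1p2:
  fixes \<mu> :: "'a::metric_space measure" and p \<eta> :: real and x\<^sub>0 :: 'a
  assumes "metric_measure_space \<mu>" and "1 \<le> p" and "0 < \<eta>"
  shows "(annular_decay_at \<mu> \<eta> x\<^sub>0 \<longrightarrow>
            (\<exists>C>0. \<forall>r R. 0 < r \<and> r < R \<longrightarrow>
               variational_capacity \<mu> p (ball x\<^sub>0 r) (ball x\<^sub>0 R)
                 \<le> ennreal (C * (1 - r / R) powr (\<eta> - p) * (measure \<mu> (ball x\<^sub>0 R) / R powr p))))
       \<and> (global_annular_decay \<mu> \<eta> \<longrightarrow>
            (\<exists>C>0. \<forall>x r R. 0 < r \<and> r < R \<longrightarrow>
               variational_capacity \<mu> p (ball x r) (ball x R)
                 \<le> ennreal (C * (1 - r / R) powr (\<eta> - p) * (measure \<mu> (ball x R) / R powr p))))"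
proof -
  interpret metric_measure_space \<mu> by fact
  show ?thesis
  proof (intro conjI impI)
    assume "annular_decay_at \<mu> \<eta> x\<^sub>0"
    then obtain C where "annular_decay_with \<mu> \<eta> C x\<^sub>0" by (auto simp: annular_decay_at_def)
    then show "\<exists>C>0. \<forall>r R. 0 < r \<and> r < R \<longrightarrow>
               variational_capacity \<mu> p (ball x\<^sub>0 r) (ball x\<^sub>0 R)
                 \<le> ennreal (C * (1 - r / R) powr (\<eta> - p) * (measure \<mu> (ball x\<^sub>0 R) / R powr p))"
      using variational_capacity_ball_le_annular_decay[OF assms(2)]
      by (intro exI[of _ "max C 1"]) auto
  next
    assume "global_annular_decay \<mu> \<eta>"
    then obtain C where "\<And>x. annular_decay_with \<mu> \<eta> C x" by (auto simp: global_annular_decay_def)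
    then show "\<exists>C>0. \<forall>x r R. 0 < r \<and> r < R \<longrightarrow>
               variational_capacity \<mu> p (ball x r) (ball x R)
                 \<le> ennreal (C * (1 - r / R) powr (\<eta> - p) * (measure \<mu> (ball x R) / R powr p))"
      using variational_capacity_ball_le_annular_decay[OF assms(2)]
      \<comment> \<open>The witness depends only on the decay constant, which here is common to all
        centres.\<close>
      by (intro exI[of _ "max C 1"]) auto
  qed
qed

end
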